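(* Let $A, B, C$ be a right regular triple of semigroups. If $A$ is a right group, then $C$ is also a right group.
   Context: A semigroup is a nonempty set with an associative multiplication. For a semigroup $S$, a nonempty set $\Lambda$ and a mapping $P:\Lambda\to S$, let $\mathcal{M}(S;\Lambda;P)$ denote the semigroup on the set $S\times\Lambda$ with multiplication $(s,\lambda)(t,\mu)=(sP(\lambda)t,\mu)$. For a semigroup $S$, $\theta_S=\{(a,b)\in S\times S: xa=xb \text{ for all } x\in S\}$; this is a congruence on $S$. A triple $A,B,C$ of semigroups is called right regular if there exist mappings (not necessarily homomorphisms) $P:B\to A$ and $P':B\to C$ such that $\mathcal{M}(A;B;P)/\theta_{\mathcal{M}(A;B;P)}\cong\mathcal{M}(C;B;P')$ as semigroups. A semigroup $S$ is left cancellative if $xa=xb$ implies $a=b$ for all $x,a,b\in S$; it is right simple if $aS=S$ for every $a\in S$; it is a right group if it is both left cancellative and right simple. *)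

theory Defs
  imports "HOL-Algebra.Group"
begin

text \<open>
  Semigroups are carried by the records of HOL-Algebra, so that its homomorphisms and its
  isomorphism relation can be used. Only the fields for the carrier and the multiplication
  are ever inspected; the field for the unit is irrelevant (a semigroup need not have one).
\<close>

locale carrier_semigroup =
  fixes S :: "('a, 'm) monoid_scheme" (structure)
  assumes carrier_nonempty: "carrier S \<noteq> {}"
    and mult_closed: "\<lbrakk>x \<in> carrier S; y \<in> carrier S\<rbrakk> \<Longrightarrow> x \<otimes> y \<in> carrier S"
    and mult_assoc:
      "\<lbrakk>x \<in> carrier S; y \<in> carrier S; z \<in> carrier S\<rbrakk> \<Longrightarrow> (x \<otimes> y) \<otimes> z = x \<otimes> (y \<otimes> z)"

definition left_cancellative :: "('a, 'm) monoid_scheme \<Rightarrow> bool"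
  where "left_cancellative S \<longleftrightarrow>
    (\<forall>x\<in>carrier S. \<forall>a\<in>carrier S. \<forall>b\<in>carrier S. x \<otimes>\<^bsub>S\<^esub> a = x \<otimes>\<^bsub>S\<^esub> b \<longrightarrow> a = b)"

definition right_simple :: "('a, 'm) monoid_scheme \<Rightarrow> bool"
  where "right_simple S \<longleftrightarrow> (\<forall>a\<in>carrier S. (\<lambda>s. a \<otimes>\<^bsub>S\<^esub> s) ` carrier S = carrier S)"

definition right_group :: "('a, 'm) monoid_scheme \<Rightarrow> bool"
  where "right_group S \<longleftrightarrow> carrier_semigroup S \<and> left_cancellative S \<and> right_simple S"

definition matrix_semigroup ::
    "('a, 'm) monoid_scheme \<Rightarrow> 'l set \<Rightarrow> ('l \<Rightarrow> 'a) \<Rightarrow> ('a \<times> 'l) monoid"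
  where "matrix_semigroup S \<Lambda> P =
    \<lparr>carrier = carrier S \<times> \<Lambda>,
     mult = (\<lambda>(s, l) (t, m). (s \<otimes>\<^bsub>S\<^esub> P l \<otimes>\<^bsub>S\<^esub> t, m)),
     one = undefined\<rparr>"

definition theta :: "('a, 'm) monoid_scheme \<Rightarrow> ('a \<times> 'a) set"
  where "theta S = {(a, b) \<in> carrier S \<times> carrier S.
    \<forall>x\<in>carrier S. x \<otimes>\<^bsub>S\<^esub> a = x \<otimes>\<^bsub>S\<^esub> b}"

definition quotient_semigroup ::
    "('a, 'm) monoid_scheme \<Rightarrow> ('a \<times> 'a) set \<Rightarrow> 'a set monoid"
  where "quotient_semigroup S r =
    \<lparr>carrier = carrier S // r,
     mult = (\<lambda>X Y. \<Union>x\<in>X. \<Union>y\<in>Y. r `` {x \<otimes>\<^bsub>S\<^esub> y}),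
     one = undefined\<rparr>"

definition right_regular_triple ::
    "('a, 'm) monoid_scheme \<Rightarrow> ('b, 'n) monoid_scheme \<Rightarrow> ('c, 'k) monoid_scheme \<Rightarrow> bool"
  where "right_regular_triple A B C \<longleftrightarrow>
    carrier_semigroup A \<and> carrier_semigroup B \<and> carrier_semigroup C \<and>
    (\<exists>P \<in> carrier B \<rightarrow> carrier A. \<exists>P' \<in> carrier B \<rightarrow> carrier C.
      quotient_semigroup (matrix_semigroup A (carrier B) P)
          (theta (matrix_semigroup A (carrier B) P))
        \<cong> matrix_semigroup C (carrier B) P')"

lemma matrix_semigroup_carrier_semigroup:
  assumes "carrier_semigroup S" and "\<Lambda> \<noteq> {}" and P: "P \<in> \<Lambda> \<rightarrow> carrier S"
  shows "carrier_semigroup (matrix_semigroup S \<Lambda> P)"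
proof -
  interpret carrier_semigroup S by fact
  have "P l \<in> carrier S" if "l \<in> \<Lambda>" for l
    using P that by auto
  then show ?thesis
    using carrier_nonempty \<open>\<Lambda> \<noteq> {}\<close>
    by unfold_locales (auto simp: matrix_semigroup_def mult_closed mult_assoc)
qed

lemma equiv_theta: "equiv (carrier S) (theta S)"
proof (rule equivI)
  show "theta S \<subseteq> carrier S \<times> carrier S"
    by (auto simp: theta_def)
  show "refl_on (carrier S) (theta S)"
    by (rule refl_onI) (simp add: theta_def)
  show "sym (theta S)"
    by (rule symI) (simp add: theta_def)
  show "trans (theta S)"
    by (rule transI) (simp add: theta_def)
qed

context carrier_semigroup
begin

lemma theta_mult:
  assumes "(a, a') \<in> theta S" and "(b, b') \<in> theta S"
  shows "(a \<otimes> b, a' \<otimes> b') \<in> theta S"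
proof -
  have ab: "a \<in> carrier S" "a' \<in> carrier S" "b \<in> carrier S" "b' \<in> carrier S"
    using assms by (auto simp: theta_def)
  have "x \<otimes> (a \<otimes> b) = x \<otimes> (a' \<otimes> b')" if x: "x \<in> carrier S" for x
  proof -
    have "x \<otimes> (a \<otimes> b) = (x \<otimes> a) \<otimes> b" using x ab by (simp add: mult_assoc)
    also have "\<dots> = (x \<otimes> a) \<otimes> b'" using assms(2) x ab by (simp add: theta_def mult_closed)
    also have "\<dots> = (x \<otimes> a') \<otimes> b'" using assms(1) x by (simp add: theta_def)
    also have "\<dots> = x \<otimes> (a' \<otimes> b')" using x ab by (simp add: mult_assoc)
    finally show ?thesis .
  qed
  then show ?thesis
    using ab by (simp add: theta_def mult_closed)
qed

lemma quotient_theta_mult_class: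
  assumes a: "a \<in> carrier S" and b: "b \<in> carrier S"
  shows "theta S `` {a} \<otimes>\<^bsub>quotient_semigroup S (theta S)\<^esub> theta S `` {b} = theta S `` {a \<otimes> b}"
proof -
  let ?U = "\<Union>x\<in>theta S `` {a}. \<Union>y\<in>theta S `` {b}. theta S `` {x \<otimes> y}"
  have "theta S `` {x \<otimes> y} = theta S `` {a \<otimes> b}"
    if "x \<in> theta S `` {a}" and "y \<in> theta S `` {b}" for x y
  proof -
    have "(a \<otimes> b, x \<otimes> y) \<in> theta S"
      using that by (intro theta_mult) simp_all
    from equiv_class_eq[OF equiv_theta this] show ?thesis ..
  qed
  then have "?U = (\<Union>x\<in>theta S `` {a}. \<Union>y\<in>theta S `` {b}. theta S `` {a \<otimes> b})"
    by (intro SUP_cong refl)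
  moreover have "theta S `` {a} \<noteq> {}" "theta S `` {b} \<noteq> {}"
    using equiv_class_self[OF equiv_theta a] equiv_class_self[OF equiv_theta b]
    by (metis empty_iff)+
  ultimately have "?U = theta S `` {a \<otimes> b}"
    by (simp only: UN_constant if_False)
  then show ?thesis
    by (simp only: quotient_semigroup_def monoid.simps)
qed

end

end

(* A right group A makes M(A;B;P) a right group, so theta is trivial on it and the matrix semigroup
   M(C;B;P') is a right group as well. This only says that left multiplication by each product
   c P'(l) is a bijection of C. Right simplicity of C is immediate; moreover P'(l) is left
   cancellable, which yields an idempotent, and a right simple semigroup with an idempotent is a
   right group. *)
theory Submission
  imports Defs
begin

lemma right_simpleD:
  assumes "right_simple S" "a \<in> carrier S" "b \<in> carrier S"
  obtains s where "s \<in> carrier S" "a \<otimes>\<^bsub>S\<^esub> s = b"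
proof -
  have "b \<in> (\<lambda>s. a \<otimes>\<^bsub>S\<^esub> s) ` carrier S"
    using assms by (auto simp: right_simple_def)
  then show thesis
    using that by blast
qed

context carrier_semigroup
begin

lemma right_simpleI:
  assumes "\<And>a b. \<lbrakk>a \<in> carrier S; b \<in> carrier S\<rbrakk> \<Longrightarrow> \<exists>s\<in>carrier S. a \<otimes> s = b"
  shows "right_simple S"
  unfolding right_simple_def
proof (intro ballI equalityI subsetI)
  show "b \<in> carrier S" if "a \<in> carrier S" "b \<in> (\<lambda>s. a \<otimes> s) ` carrier S" for a b
    using that by (auto simp: mult_closed)
  show "b \<in> (\<lambda>s. a \<otimes> s) ` carrier S" if "a \<in> carrier S" "b \<in> carrier S" for a b
    using assms[OF that] by blast
qed

text \<open>By right simplicity every \<open>c\<close> is a right multiple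
  \<open>e \<otimes> s\<close>, and a further factor \<open>e\<close> on the left is absorbed by
  idempotency.\<close>

lemma idempotent_left_unit:
  assumes "right_simple S" "e \<in> carrier S" "e \<otimes> e = e" "c \<in> carrier S"
  shows "e \<otimes> c = c"
proof -
  obtain s where "s \<in> carrier S" "e \<otimes> s = c"
    using right_simpleD assms by metis
  then show ?thesis
    using assms mult_assoc by metis
qed

text \<open>Relative to the left unit \<open>e\<close>, right simplicity gives each \<open>x\<close>
  a right inverse \<open>y\<close>. Although \<open>y \<otimes> x\<close> may differ from
  \<open>e\<close>, it is idempotent too and hence another left unit, so left multiplication by
  \<open>y\<close> undoes left multiplication by \<open>x\<close>.\<close>

lemma right_simple_idempotent_imp_right_group:
  assumes rs: "right_simple S" and e: "e \<in> carrier S" "e \<otimes> e = e"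
  shows "right_group S"
proof -
  have "a = b" if x: "x \<in> carrier S" and ab: "a \<in> carrier S" "b \<in> carrier S" "x \<otimes> a = x \<otimes> b"
    for x a b
  proof -
    obtain y where y: "y \<in> carrier S" "x \<otimes> y = e"
      using right_simpleD[OF rs x e(1)] by blast
    \<comment> \<open>Regrouping exposes the inner product \<open>x \<otimes> y = e\<close>, which
      then disappears in front of \<open>x\<close>.\<close>
    have "(y \<otimes> x) \<otimes> (y \<otimes> x) = y \<otimes> ((x \<otimes> y) \<otimes> x)"
      using x y(1) by (simp add: mult_assoc mult_closed)
    also have "\<dots> = y \<otimes> x"
      using y(2) idempotent_left_unit[OF rs e x] by simp
    finally have unit: "(y \<otimes> x) \<otimes> c = c" if "c \<in> carrier S" for c
      using idempotent_left_unit[OF rs] that x y(1) mult_closed by blast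
    have "a = y \<otimes> (x \<otimes> a)"
      using unit ab x y(1) by (metis mult_assoc)
    also have "\<dots> = b"
      using unit ab x y(1) by (metis mult_assoc)
    finally show ?thesis .
  qed
  then show ?thesis
    using rs carrier_semigroup_axioms by (auto simp: right_group_def left_cancellative_def)
qed

text \<open>A related pair agrees after left multiplication by every element; since the carrier is
  nonempty, there is at least one element to cancel.\<close>

lemma left_cancellative_theta:
  assumes "left_cancellative S"
  shows "theta S = Id_on (carrier S)"
  using assms carrier_nonempty by (auto simp: theta_def left_cancellative_def)

text \<open>All classes are singletons, so the canonical projection is injective; it is always a
  surjective homomorphism.\<close>

lemma left_cancellative_iso_quotient_theta:
  assumes "left_cancellative S"
  shows "S \<cong> quotient_semigroup S (theta S)"
proof -
  let ?r = "theta S"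
  have cls: "?r `` {a} = {a}" if "a \<in> carrier S" for a
    using left_cancellative_theta[OF assms] that by auto
  have carrier: "carrier (quotient_semigroup S ?r) = (\<lambda>a. ?r `` {a}) ` carrier S"
    by (auto simp: quotient_semigroup_def quotient_def)
  have "(\<lambda>a. ?r `` {a}) \<in> hom S (quotient_semigroup S ?r)"
    by (simp add: hom_def carrier quotient_theta_mult_class)
  moreover have "inj_on (\<lambda>a. ?r `` {a}) (carrier S)"
    by (rule inj_onI) (simp add: cls)
  ultimately have "(\<lambda>a. ?r `` {a}) \<in> iso S (quotient_semigroup S ?r)"
    by (simp add: iso_def bij_betw_def carrier)
  then show ?thesis
    by (auto simp: is_iso_def)
qed

end

lemma right_group_iso:
  assumes "right_group S" "S \<cong> T" "carrier_semigroup T"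
  shows "right_group T"
proof -
  interpret S: carrier_semigroup S
    using assms(1) by (simp add: right_group_def)
  interpret T: carrier_semigroup T
    by fact
  obtain h where h: "h \<in> iso S T"
    using assms(2) by (auto simp: is_iso_def)
  have inj: "inj_on h (carrier S)" and surj: "h ` carrier S = carrier T"
    and mult: "\<And>x y. \<lbrakk>x \<in> carrier S; y \<in> carrier S\<rbrakk> \<Longrightarrow> h (x \<otimes>\<^bsub>S\<^esub> y) = h x \<otimes>\<^bsub>T\<^esub> h y"
    using h by (auto simp: iso_def hom_def bij_betw_def)
  have "left_cancellative T"
    \<comment> \<open>Writing the carrier of \<open>T\<close> as the image under \<open>h\<close>
      turns the quantifiers over \<open>T\<close> into quantifiers over \<open>S\<close>.\<close>
    unfolding left_cancellative_def surj[symmetric] ball_simps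
  proof (intro ballI impI)
    fix x a b
    assume xab: "x \<in> carrier S" "a \<in> carrier S" "b \<in> carrier S"
      and eq: "h x \<otimes>\<^bsub>T\<^esub> h a = h x \<otimes>\<^bsub>T\<^esub> h b"
    have "x \<otimes>\<^bsub>S\<^esub> a = x \<otimes>\<^bsub>S\<^esub> b"
      using inj eq xab by (simp add: mult[symmetric] inj_on_eq_iff S.mult_closed)
    then show "h a = h b"
      using assms(1) xab by (auto simp: right_group_def left_cancellative_def)
  qed
  moreover have "right_simple T"
  proof (rule T.right_simpleI)
    fix a b
    assume "a \<in> carrier T" "b \<in> carrier T"
    then obtain a' b' where ab: "a' \<in> carrier S" "b' \<in> carrier S" "a = h a'" "b = h b'"
      using surj by blast
    obtain s where s: "s \<in> carrier S" "a' \<otimes>\<^bsub>S\<^esub> s = b'"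
      using right_simpleD[OF _ ab(1,2)] assms(1) by (auto simp: right_group_def)
    have "a \<otimes>\<^bsub>T\<^esub> h s = b"
      using ab s by (simp add: mult[symmetric])
    moreover have "h s \<in> carrier T"
      using s(1) surj by blast
    ultimately show "\<exists>s\<in>carrier T. a \<otimes>\<^bsub>T\<^esub> s = b" ..
  qed
  ultimately show ?thesis
    using assms(3) by (simp add: right_group_def)
qed

text \<open>Left multiplication by \<open>(s, l)\<close> acts on first coordinates as left
  multiplication by \<open>s \<otimes> P l\<close> and fixes second coordinates, so it inherits
  bijectivity from \<open>S\<close>.\<close>

lemma right_group_matrix_semigroup:
  assumes "right_group S" "\<Lambda> \<noteq> {}" "P \<in> \<Lambda> \<rightarrow> carrier S"
  shows "right_group (matrix_semigroup S \<Lambda> P)"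
proof -
  interpret S: carrier_semigroup S
    using assms(1) by (simp add: right_group_def)
  interpret M: carrier_semigroup "matrix_semigroup S \<Lambda> P"
    using S.carrier_semigroup_axioms assms(2,3) by (rule matrix_semigroup_carrier_semigroup)
  have rs: "right_simple S" and lc: "left_cancellative S"
    using assms(1) by (auto simp: right_group_def)
  have sP: "s \<otimes>\<^bsub>S\<^esub> P l \<in> carrier S" if "s \<in> carrier S" "l \<in> \<Lambda>" for s l
    using that assms(3) S.mult_closed by blast
  have "left_cancellative (matrix_semigroup S \<Lambda> P)"
    using lc sP by (auto simp: left_cancellative_def matrix_semigroup_def)
  moreover have "right_simple (matrix_semigroup S \<Lambda> P)"
  proof (rule M.right_simpleI)
    fix x y
    assume "x \<in> carrier (matrix_semigroup S \<Lambda> P)" "y \<in> carrier (matrix_semigroup S \<Lambda> P)"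
    then obtain s l t m where x: "x = (s, l)" "s \<in> carrier S" "l \<in> \<Lambda>"
      and y: "y = (t, m)" "t \<in> carrier S" "m \<in> \<Lambda>"
      by (auto simp: matrix_semigroup_def)
    obtain u where "u \<in> carrier S" "s \<otimes>\<^bsub>S\<^esub> P l \<otimes>\<^bsub>S\<^esub> u = t"
      using right_simpleD[OF rs sP[OF x(2,3)] y(2)] by blast
    then show "\<exists>u\<in>carrier (matrix_semigroup S \<Lambda> P). x \<otimes>\<^bsub>matrix_semigroup S \<Lambda> P\<^esub> u = y"
      \<comment> \<open>A product takes its second coordinate from the right factor, which forces
        the index \<open>m\<close> in the witness.\<close>
      using x y by (intro bexI[of _ "(u, m)"]) (auto simp: matrix_semigroup_def)
  qed
  ultimately show ?thesis
    using M.carrier_semigroup_axioms by (simp add: right_group_def)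
qed

lemma right_group_if_right_group_matrix_semigroup:
  assumes "carrier_semigroup S" "\<Lambda> \<noteq> {}" and P: "P \<in> \<Lambda> \<rightarrow> carrier S"
    and M: "right_group (matrix_semigroup S \<Lambda> P)"
  shows "right_group S"
proof -
  interpret S: carrier_semigroup S
    by fact
  obtain l where l: "l \<in> \<Lambda>"
    using assms(2) by blast
  then have p: "P l \<in> carrier S"
    using P by blast
  \<comment> \<open>This is right simplicity of the matrix semigroup, read off in the first
    coordinate for one fixed index \<open>l\<close>.\<close>
  have solve: "\<exists>u\<in>carrier S. s \<otimes>\<^bsub>S\<^esub> P l \<otimes>\<^bsub>S\<^esub> u = t"
    if st: "s \<in> carrier S" "t \<in> carrier S" for s t
  proof -
    have "right_simple (matrix_semigroup S \<Lambda> P)"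
      using M by (simp add: right_group_def)
    then obtain x where "x \<in> carrier (matrix_semigroup S \<Lambda> P)"
      "(s, l) \<otimes>\<^bsub>matrix_semigroup S \<Lambda> P\<^esub> x = (t, l)"
      using st l by (elim right_simpleD[of _ "(s, l)" "(t, l)"]) (auto simp: matrix_semigroup_def)
    then show ?thesis
      by (auto simp: matrix_semigroup_def)
  qed
  have rs: "right_simple S"
  proof (rule S.right_simpleI)
    fix a b
    assume "a \<in> carrier S" "b \<in> carrier S"
    then show "\<exists>s\<in>carrier S. a \<otimes>\<^bsub>S\<^esub> s = b"
      \<comment> \<open>Associativity turns a solution \<open>u\<close> of \<open>solve\<close> into
        the witness \<open>P l \<otimes> u\<close>.\<close>
      using solve p S.mult_closed S.mult_assoc by metis
  qed
  \<comment> \<open>Cancellation in the matrix semigroup concerns only multipliers of the form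
    \<open>s \<otimes> P l\<close>. Prefixing another \<open>P l\<close> brings the equation into
    this form, with \<open>s = P l\<close>.\<close>
  have cancel: "a = b"
    if "a \<in> carrier S" "b \<in> carrier S" "P l \<otimes>\<^bsub>S\<^esub> a = P l \<otimes>\<^bsub>S\<^esub> b" for a b
  proof -
    have "P l \<otimes>\<^bsub>S\<^esub> P l \<otimes>\<^bsub>S\<^esub> a = P l \<otimes>\<^bsub>S\<^esub> P l \<otimes>\<^bsub>S\<^esub> b"
      using that p by (simp add: S.mult_assoc)
    then have "(P l, l) \<otimes>\<^bsub>matrix_semigroup S \<Lambda> P\<^esub> (a, l)
        = (P l, l) \<otimes>\<^bsub>matrix_semigroup S \<Lambda> P\<^esub> (b, l)"
      by (simp add: matrix_semigroup_def)
    moreover have "(c, l) \<in> carrier (matrix_semigroup S \<Lambda> P)" if "c \<in> carrier S" for c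
      using that l by (simp add: matrix_semigroup_def)
    ultimately have "(a, l) = (b, l)"
      using M that p unfolding right_group_def left_cancellative_def by blast
    then show ?thesis
      by simp
  qed
  \<comment> \<open>A right unit for the single element \<open>P l\<close> suffices:
    \<open>P l\<close> absorbs both \<open>e\<close> and \<open>e \<otimes> e\<close>, and
    cancelling it makes \<open>e\<close> idempotent.\<close>
  obtain e where e: "e \<in> carrier S" "P l \<otimes>\<^bsub>S\<^esub> e = P l"
    using right_simpleD[OF rs p p] by blast
  have "P l \<otimes>\<^bsub>S\<^esub> (e \<otimes>\<^bsub>S\<^esub> e) = P l \<otimes>\<^bsub>S\<^esub> e"
    using e p S.mult_assoc by metis
  then have "e \<otimes>\<^bsub>S\<^esub> e = e"
    using cancel e(1) S.mult_closed by blast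
  then show ?thesis
    using S.right_simple_idempotent_imp_right_group rs e(1) by blast
qed

theorem theorem2:
  fixes A :: "('a, 'm) monoid_scheme"
    and B :: "('b, 'n) monoid_scheme"
    and C :: "('c, 'k) monoid_scheme"
  assumes "right_regular_triple A B C"
    and "right_group A"
  shows "right_group C"
proof -
  obtain P P' where C: "carrier_semigroup C" and B: "carrier_semigroup B"
    and P: "P \<in> carrier B \<rightarrow> carrier A" and P': "P' \<in> carrier B \<rightarrow> carrier C"
    and iso: "quotient_semigroup (matrix_semigroup A (carrier B) P)
          (theta (matrix_semigroup A (carrier B) P)) \<cong> matrix_semigroup C (carrier B) P'"
    using assms(1) by (auto simp: right_regular_triple_def)
  have ne: "carrier B \<noteq> {}"
    using B by (rule carrier_semigroup.carrier_nonempty)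
  have M: "right_group (matrix_semigroup A (carrier B) P)"
    using assms(2) ne P by (rule right_group_matrix_semigroup)
  \<comment> \<open>Left cancellativity identifies the matrix semigroup over \<open>A\<close> with
    its quotient by \<open>theta\<close>; composing with \<open>iso\<close> removes the
    quotient.\<close>
  then have "matrix_semigroup A (carrier B) P \<cong> matrix_semigroup C (carrier B) P'"
    using carrier_semigroup.left_cancellative_iso_quotient_theta iso iso_trans
    unfolding right_group_def by blast
  then have "right_group (matrix_semigroup C (carrier B) P')"
    using matrix_semigroup_carrier_semigroup[OF C ne P'] by (rule right_group_iso[OF M])
  with C ne P' show ?thesis
    by (rule right_group_if_right_group_matrix_semigroup)
qed

end
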